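(* Let $R$ be a prime principal ideal ring. Then either $R$ has a maximal subring or $R$ is a duo principal ideal domain. Moreover, if $R$ is a principal ideal domain which is not a duo ring, then $R$ has a maximal subring of the form $xRx^{-1}\cap R$ or $x^{-1}Rx\cap R$ for some atom $x\in R$, where $xRx^{-1}$ and $x^{-1}Rx$ are computed in the division ring of quotients of $R$.
   Context: All rings are associative with identity $1\neq0$; subrings contain the identity. A maximal subring of $R$ is a proper subring with no subring strictly between it and $R$. A principal ideal ring is a ring in which every left ideal and every right ideal is principal; a principal ideal domain is such a ring without zero divisors (it is then an Ore domain and has a division ring of quotients). A ring is prime if $aRb=0$ implies $a=0$ or $b=0$. A ring is duo if every one-sided ideal is two-sided. An atom is a nonzero non-unit which cannot be written as a product of two non-units. *)

theory Defs
  imports Main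
begin

text \<open>The ring R is the type 'a (class ring_1, so 1 \<noteq> 0). Subsets of the
type play the role of subrings / one-sided ideals.\<close>

definition subring :: "'a::ring_1 set \<Rightarrow> bool" where
  "subring S \<longleftrightarrow> 1 \<in> S \<and> (\<forall>a\<in>S. \<forall>b\<in>S. a - b \<in> S \<and> a * b \<in> S)"

definition maximal_subring :: "'a::ring_1 set \<Rightarrow> bool" where
  "maximal_subring S \<longleftrightarrow> subring S \<and> S \<noteq> UNIV \<and>
     (\<forall>T. subring T \<and> S \<subseteq> T \<longrightarrow> T = S \<or> T = UNIV)"

definition has_maximal_subring :: "'a::ring_1 itself \<Rightarrow> bool" where
  "has_maximal_subring _ \<longleftrightarrow> (\<exists>S::'a set. maximal_subring S)"

definition left_ideal :: "'a::ring_1 set \<Rightarrow> bool" where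
  "left_ideal I \<longleftrightarrow> 0 \<in> I \<and> (\<forall>a\<in>I. \<forall>b\<in>I. a - b \<in> I) \<and> (\<forall>r. \<forall>a\<in>I. r * a \<in> I)"

definition right_ideal :: "'a::ring_1 set \<Rightarrow> bool" where
  "right_ideal I \<longleftrightarrow> 0 \<in> I \<and> (\<forall>a\<in>I. \<forall>b\<in>I. a - b \<in> I) \<and> (\<forall>r. \<forall>a\<in>I. a * r \<in> I)"

definition principal_ideal_ring :: "'a::ring_1 itself \<Rightarrow> bool" where
  "principal_ideal_ring _ \<longleftrightarrow>
     (\<forall>I::'a set. left_ideal I \<longrightarrow> (\<exists>a. I = range (\<lambda>r. r * a))) \<and>
     (\<forall>I::'a set. right_ideal I \<longrightarrow> (\<exists>a. I = range (\<lambda>r. a * r)))"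

definition no_zero_divisors_ring :: "'a::ring_1 itself \<Rightarrow> bool" where
  "no_zero_divisors_ring _ \<longleftrightarrow> (\<forall>a b::'a. a * b = 0 \<longrightarrow> a = 0 \<or> b = 0)"

definition principal_ideal_domain :: "'a::ring_1 itself \<Rightarrow> bool" where
  "principal_ideal_domain T \<longleftrightarrow> principal_ideal_ring T \<and> no_zero_divisors_ring T"

definition prime_ring :: "'a::ring_1 itself \<Rightarrow> bool" where
  "prime_ring _ \<longleftrightarrow> (\<forall>a b::'a. (\<forall>r. a * r * b = 0) \<longrightarrow> a = 0 \<or> b = 0)"

definition duo_ring :: "'a::ring_1 itself \<Rightarrow> bool" where
  "duo_ring _ \<longleftrightarrow> (\<forall>I::'a set. (left_ideal I \<longrightarrow> right_ideal I) \<and> (right_ideal I \<longrightarrow> left_ideal I))"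

definition is_unit :: "'a::ring_1 \<Rightarrow> bool" where
  "is_unit x \<longleftrightarrow> (\<exists>y. x * y = 1 \<and> y * x = 1)"

definition atom :: "'a::ring_1 \<Rightarrow> bool" where
  "atom x \<longleftrightarrow> x \<noteq> 0 \<and> \<not> is_unit x \<and> \<not> (\<exists>a b. \<not> is_unit a \<and> \<not> is_unit b \<and> x = a * b)"

definition division_ring_of_quotients :: "('a::ring_1 \<Rightarrow> 'b::division_ring) \<Rightarrow> bool" where
  "division_ring_of_quotients phi \<longleftrightarrow> inj phi \<and> phi 1 = 1 \<and>
     (\<forall>a b. phi (a + b) = phi a + phi b \<and> phi (a * b) = phi a * phi b) \<and>
     (\<forall>q. \<exists>a b. b \<noteq> 0 \<and> q = phi a * inverse (phi b))"

definition conj_left :: "('a::ring_1 \<Rightarrow> 'b::division_ring) \<Rightarrow> 'a \<Rightarrow> 'a set" where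
  "conj_left phi x = {r. phi r \<in> (\<lambda>s. phi x * phi s * inverse (phi x)) ` UNIV}"

definition conj_right :: "('a::ring_1 \<Rightarrow> 'b::division_ring) \<Rightarrow> 'a \<Rightarrow> 'a set" where
  "conj_right phi x = {r. phi r \<in> (\<lambda>s. inverse (phi x) * phi s * phi x) ` UNIV}"

end

theory Submission
  imports Defs
begin

text \<open>If a maximal right ideal \<open>M\<close> is not two-sided, its idealizer is a maximal subring: for \<open>t\<close>
  outside the idealizer, \<open>t M + M\<close> is a right ideal strictly above \<open>M\<close>, hence everything.  For a
  domain and \<open>M = x R\<close>, the element \<open>x\<close> is an atom and the idealizer is \<open>x R x\<^sup>-\<^sup>1 \<inter> R\<close>.
  Otherwise every maximal right ideal of \<open>R\<close> is two-sided.  In a prime principal ideal ring, a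
  nonzero two-sided ideal is generated by a regular normal element \<open>a\<close>, and \<open>\<Inter>n. a\<^sup>n R = 0\<close>
  unless \<open>a\<close> is a unit.  Splitting off such factors with the ascending chain condition shows
  first that \<open>R\<close> is a domain and then that each nonzero element is normal.\<close>

section \<open>Right ideals and the idealizer as a subring\<close>

definition maximal_right_ideal :: "'a::ring_1 set \<Rightarrow> bool" where
  "maximal_right_ideal M \<longleftrightarrow> right_ideal M \<and> M \<noteq> UNIV \<and>
     (\<forall>J. right_ideal J \<and> M \<subseteq> J \<longrightarrow> J = M \<or> J = UNIV)"

text \<open>For a right ideal \<open>M\<close> this is the largest subring in which \<open>M\<close>
  is a two-sided ideal: right multiplication preserves \<open>M\<close> anyway, so only left
  multiplication is tested.\<close>

definition idealizer :: "'a::ring_1 set \<Rightarrow> 'a set" where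
  "idealizer M = {r. \<forall>m\<in>M. r * m \<in> M}"

definition regular :: "'a::ring_1 \<Rightarrow> bool" where
  "regular a \<longleftrightarrow> (\<forall>c. (a * c = 0 \<longrightarrow> c = 0) \<and> (c * a = 0 \<longrightarrow> c = 0))"

text \<open>Regularity is kept separate, so \<open>0\<close> counts as normal; this lets normality
  be proved for every element at once.\<close>

definition normal_element :: "'a::ring_1 \<Rightarrow> bool" where
  "normal_element a \<longleftrightarrow> range (\<lambda>r. a * r) = range (\<lambda>r. r * a)"

lemma right_ideal_range: "right_ideal (range (\<lambda>r. a * r))"
proof -
  have "0 \<in> range (\<lambda>r. a * r)"
    by (metis mult_zero_right rangeI)
  moreover have "a * r - a * s \<in> range (\<lambda>r. a * r)" for r s
    by (metis right_diff_distrib rangeI)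
  moreover have "a * r * s \<in> range (\<lambda>r. a * r)" for r s
    by (metis mult.assoc rangeI)
  ultimately show ?thesis
    unfolding right_ideal_def by auto
qed

lemma left_ideal_range: "left_ideal (range (\<lambda>r. r * a))"
proof -
  have "0 \<in> range (\<lambda>r. r * a)"
    by (metis mult_zero_left rangeI)
  moreover have "r * a - s * a \<in> range (\<lambda>r. r * a)" for r s
    by (metis left_diff_distrib rangeI)
  moreover have "s * (r * a) \<in> range (\<lambda>r. r * a)" for r s
    by (metis mult.assoc rangeI)
  ultimately show ?thesis
    unfolding left_ideal_def by auto
qed

lemma right_ideal_eq_UNIV: "right_ideal I \<Longrightarrow> 1 \<in> I \<Longrightarrow> I = UNIV"
  unfolding right_ideal_def by (metis UNIV_eq_I mult_1_left)

lemma right_ideal_INT: "(\<And>n. right_ideal (I n)) \<Longrightarrow> right_ideal (\<Inter>n. I n)"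
  unfolding right_ideal_def by simp

lemma right_ideal_right_annihilator: "right_ideal {c. a * c = 0}"
  unfolding right_ideal_def by (auto simp: right_diff_distrib mult.assoc[symmetric])

text \<open>The failure of \<open>left_ideal M\<close> makes the idealizer proper; maximality of
  \<open>M\<close> as a right ideal leaves no room for a larger proper subring.\<close>

lemma maximal_subring_idealizer:
  assumes M: "maximal_right_ideal M" and "\<not> left_ideal M"
  shows "maximal_subring (idealizer M)"
proof -
  have rM: "right_ideal M" and max: "\<And>J. right_ideal J \<Longrightarrow> M \<subseteq> J \<Longrightarrow> J = M \<or> J = UNIV"
    using M unfolding maximal_right_ideal_def by auto
  have "subring (idealizer M)"
    using rM unfolding subring_def idealizer_def right_ideal_def
    by (auto simp: left_diff_distrib mult.assoc)
  moreover have "idealizer M \<noteq> UNIV"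
    using assms(2) rM unfolding idealizer_def left_ideal_def right_ideal_def by auto
  moreover have "S = UNIV" if S: "subring S" "idealizer M \<subseteq> S" "S \<noteq> idealizer M" for S
  proof -
    obtain t where t: "t \<in> S" "t \<notin> idealizer M"
      using S by auto
    then obtain m where m: "m \<in> M" "t * m \<notin> M"
      unfolding idealizer_def by auto
    define J where "J = {t * u + v | u v. u \<in> M \<and> v \<in> M}"
    have zero: "0 \<in> M"
      using rM unfolding right_ideal_def by simp
    have inJ: "t * u + v \<in> J" if "u \<in> M" "v \<in> M" for u v
      using that unfolding J_def by blast
    have "right_ideal J"
      unfolding right_ideal_def
    proof (intro conjI ballI allI)
      show "0 \<in> J"
        using inJ[OF zero zero] by simp
    next
      fix a b assume "a \<in> J" "b \<in> J"
      then obtain u v u' v' where "a = t * u + v" "b = t * u' + v'"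
          and *: "u \<in> M" "v \<in> M" "u' \<in> M" "v' \<in> M"
        unfolding J_def by blast
      then have "a - b = t * (u - u') + (v - v')"
        by (simp add: algebra_simps)
      then show "a - b \<in> J"
        using inJ * rM unfolding right_ideal_def by simp
    next
      fix r a assume "a \<in> J"
      then obtain u v where "a = t * u + v" and *: "u \<in> M" "v \<in> M"
        unfolding J_def by blast
      then have "a * r = t * (u * r) + v * r"
        by (simp add: algebra_simps)
      then show "a * r \<in> J"
        using inJ * rM unfolding right_ideal_def by simp
    qed
    moreover have "M \<subseteq> J"
      using inJ[OF zero] by auto
    moreover have "t * m \<in> J"
      using inJ[OF m(1) zero] by simp
    ultimately have "J = UNIV"
      using max m by auto
    have MS: "M \<subseteq> S"
      using S(2) rM unfolding idealizer_def right_ideal_def by auto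
    \<comment> \<open>\<open>M\<close> lies in its own idealizer, hence in \<open>S\<close>, and
      \<open>t\<close> lies in \<open>S\<close>. Since \<open>subring\<close> speaks of differences,
      the sum is written as \<open>t * u - (0 - v)\<close>.\<close>
    have "J \<subseteq> S"
    proof
      fix a assume "a \<in> J"
      then obtain u v where a: "a = t * u + v" "u \<in> M" "v \<in> M"
        unfolding J_def by blast
      have "0 - v \<in> M"
        using rM a zero unfolding right_ideal_def by blast
      then have "t * u - (0 - v) \<in> S"
        using MS a t S(1) unfolding subring_def by blast
      then show "a \<in> S"
        using a by simp
    qed
    then show ?thesis
      using \<open>J = UNIV\<close> by auto
  qed
  ultimately show ?thesis
    unfolding maximal_subring_def by blast
qed

section \<open>Ascending chain condition on right ideals\<close>

text \<open>The union of the chain is a right ideal, hence principal, and its generator already lies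
  in some \<open>I n\<close>.\<close>

lemma right_ideal_chain_stabilizes:
  fixes T :: "'a::ring_1 itself" and I :: "nat \<Rightarrow> 'a set"
  assumes "principal_ideal_ring T" and I: "\<And>n. right_ideal (I n)" and mono: "mono I"
  shows "\<exists>n. \<forall>m\<ge>n. I m = I n"
proof -
  let ?U = "\<Union>n. I n"
  have "right_ideal ?U"
    unfolding right_ideal_def
  proof (intro conjI ballI allI)
    show "0 \<in> ?U"
      using I unfolding right_ideal_def by auto
  next
    fix a b assume "a \<in> ?U" "b \<in> ?U"
    then obtain m n where "a \<in> I m" "b \<in> I n"
      by auto
    then have "a \<in> I (max m n)" "b \<in> I (max m n)"
      using monoD[OF mono] by (meson max.cobounded1 max.cobounded2 subsetD)+
    then show "a - b \<in> ?U"
      using I unfolding right_ideal_def by blast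
  next
    fix r a assume "a \<in> ?U"
    then obtain n where "a \<in> I n"
      by auto
    then have "a * r \<in> I n"
      using I[of n] unfolding right_ideal_def by simp
    then show "a * r \<in> ?U"
      by auto
  qed
  then obtain a where a: "?U = range (\<lambda>r. a * r)"
    using assms(1) unfolding principal_ideal_ring_def by blast
  have "a * 1 \<in> ?U"
    unfolding a by (rule rangeI)
  then obtain n where n: "a \<in> I n"
    by auto
  have "?U \<subseteq> I n"
    unfolding a using I[of n] n unfolding right_ideal_def by auto
  then have "I m = I n" if "m \<ge> n" for m
    using monoD[OF mono that] by blast
  then show ?thesis by blast
qed

text \<open>The order is reverse inclusion: minimal elements are maximal ideals, and induction
  descends from larger right ideals to smaller ones.\<close>

lemma wf_right_ideals:
  fixes T :: "'a::ring_1 itself"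
  assumes "principal_ideal_ring T"
  shows "wf {(J, I :: 'a set). right_ideal I \<and> right_ideal J \<and> I \<subset> J}"
  unfolding wf_iff_no_infinite_down_chain
proof
  assume "\<exists>f. \<forall>i. (f (Suc i), f i) \<in> {(J, I :: 'a set). right_ideal I \<and> right_ideal J \<and> I \<subset> J}"
  then obtain f :: "nat \<Rightarrow> 'a set" where f: "\<And>i. right_ideal (f i)" "\<And>i. f i \<subset> f (Suc i)"
    unfolding mem_Collect_eq case_prod_conv by metis
  then have "mono f"
    by (intro monoI, elim lift_Suc_mono_le[rotated]) auto
  then obtain n where "\<forall>m\<ge>n. f m = f n"
    using right_ideal_chain_stabilizes[of T f, OF assms f(1)] by blast
  then have "f (Suc n) = f n"
    using le_SucI by blast
  then show False
    using f(2)[of n] by simp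
qed

lemma exists_maximal_right_ideal:
  fixes T :: "'a::ring_1 itself" and I :: "'a set"
  assumes pir: "principal_ideal_ring T" and "right_ideal I" "I \<noteq> UNIV"
  shows "\<exists>M. maximal_right_ideal M \<and> I \<subseteq> M"
proof -
  let ?Q = "{J. right_ideal J \<and> I \<subseteq> J \<and> J \<noteq> UNIV}"
  have "I \<in> ?Q"
    using assms by auto
  then obtain M where "M \<in> ?Q"
      "\<And>J. (J, M) \<in> {(J, I). right_ideal I \<and> right_ideal J \<and> I \<subset> J} \<Longrightarrow> J \<notin> ?Q"
    by (rule wfE_min[OF wf_right_ideals[OF pir]]) blast
  then show ?thesis
    unfolding maximal_right_ideal_def by (intro exI[of _ M]) blast
qed

text \<open>The right annihilators of the powers of \<open>a\<close> form an ascending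
  chain.\<close>

lemma right_annihilator_power_stabilizes:
  fixes T :: "'a::ring_1 itself" and a :: 'a
  assumes "principal_ideal_ring T"
  shows "\<exists>n. \<forall>c. a ^ Suc n * c = 0 \<longrightarrow> a ^ n * c = 0"
proof -
  have "mono (\<lambda>n. {c. a ^ n * c = 0})"
    by (intro monoI, elim lift_Suc_mono_le[rotated]) (auto simp: mult.assoc)
  then obtain n where "\<forall>m\<ge>n. {c. a ^ m * c = 0} = {c. a ^ n * c = 0}"
    using right_ideal_chain_stabilizes[OF assms right_ideal_right_annihilator] by blast
  then have "{c. a ^ Suc n * c = 0} = {c. a ^ n * c = 0}"
    using le_SucI by blast
  then show ?thesis by blast
qed

text \<open>The element \<open>y = v * u - 1\<close> satisfies \<open>u * y = 0\<close>, and
  \<open>y = u ^ n * (v ^ n * y)\<close>. So \<open>u ^ Suc n\<close> kills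
  \<open>v ^ n * y\<close>, and by stabilization \<open>u ^ n\<close> does too, which says
  \<open>y = 0\<close>.\<close>

lemma right_inverse_imp_left_inverse:
  fixes T :: "'a::ring_1 itself" and u v :: 'a
  assumes "principal_ideal_ring T" and uv: "u * v = 1"
  shows "v * u = 1"
proof -
  obtain n where n: "\<And>c. u ^ Suc n * c = 0 \<Longrightarrow> u ^ n * c = 0"
    using right_annihilator_power_stabilizes[OF assms(1)] by blast
  have uvn: "u ^ k * v ^ k = 1" for k
  proof (induction k)
    case (Suc k)
    have "u ^ Suc k * v ^ Suc k = u ^ k * (u * v) * v ^ k"
      unfolding power_Suc2[of u] power_Suc[of v] by (simp only: mult.assoc)
    then show ?case
      using Suc uv by simp
  qed simp
  let ?y = "v * u - 1"
  have "u ^ Suc n * (v ^ n * ?y) = u * (u ^ n * v ^ n) * ?y"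
    by (simp only: power_Suc mult.assoc)
  also have "\<dots> = u * v * u - u"
    by (simp add: uvn right_diff_distrib mult.assoc)
  finally have "u ^ n * (v ^ n * ?y) = 0"
    using n uv by simp
  then show ?thesis
    by (simp add: uvn mult.assoc[symmetric])
qed

section \<open>Normal generators of two-sided ideals\<close>

lemma power_normal_left:
  fixes a :: "'a::ring_1"
  assumes a: "\<And>r. \<exists>s. r * a = a * s"
  shows "\<exists>s. r * a ^ n = a ^ n * s"
proof (induction n arbitrary: r)
  case (Suc n)
  obtain s where s: "r * a = a * s"
    using a by blast
  obtain t where "s * a ^ n = a ^ n * t"
    using Suc by blast
  then have "r * a ^ Suc n = a ^ Suc n * t"
    using s by (simp add: mult.assoc[symmetric]) (simp add: mult.assoc)
  then show ?case by blast
qed auto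

text \<open>Let \<open>a\<close> generate \<open>I\<close> as a right ideal and \<open>b\<close> as
  a left ideal. Primeness and stabilizing annihilators make \<open>a\<close> regular; then
  \<open>a\<close> and \<open>b\<close> differ by a unit, so \<open>a\<close> generates
  \<open>I\<close> on the left as well.\<close>

lemma two_sided_ideal_generator:
  fixes T :: "'a::ring_1 itself" and I :: "'a set"
  assumes prime: "prime_ring T" and pir: "principal_ideal_ring T"
    and I: "left_ideal I" "right_ideal I" "I \<noteq> {0}"
  shows "\<exists>a. regular a \<and> normal_element a \<and> I = range (\<lambda>r. a * r)"
proof -
  have pr: "a = 0 \<or> b = 0" if "\<And>r. a * r * b = 0" for a b :: 'a
    using prime that unfolding prime_ring_def by blast
  obtain a where a: "I = range (\<lambda>r. a * r)"
    using pir I unfolding principal_ideal_ring_def by blast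
  obtain b where b: "I = range (\<lambda>r. r * b)"
    using pir I unfolding principal_ideal_ring_def by blast
  have aI: "a \<in> I" and bI: "b \<in> I"
    using a b by (metis mult_1_right rangeI, metis mult_1_left rangeI)
  have a0: "a \<noteq> 0"
    using I a by auto
  have swap: "\<exists>s. r * a = a * s" for r
    using I(1) aI a unfolding left_ideal_def by blast
  have l: "c = 0" if "c * a = 0" for c
  proof -
    have "c * r * a = 0" for r
      using swap[of r] that by (metis mult.assoc mult_zero_left)
    then show ?thesis
      using pr a0 by blast
  qed
  have lpow: "c = 0" if "c * a ^ n = 0" for c n
    using that
  proof (induction n)
    case (Suc n)
    then have "c * a ^ n * a = 0"
      unfolding power_Suc2 by (simp only: mult.assoc)
    then show ?case
      using l Suc.IH by blast
  qed simp
  have r: "c = 0" if c: "a * c = 0" for c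
  proof -
    obtain n where n: "\<And>c. a ^ Suc n * c = 0 \<Longrightarrow> a ^ n * c = 0"
      using right_annihilator_power_stabilizes[OF pir] by blast
    \<comment> \<open>Moving \<open>a ^ n\<close> to the front gives \<open>a ^ n * s\<close>; one
      more factor \<open>a\<close> kills it because \<open>a * c = 0\<close>, so stabilization
      applies. Primeness then yields \<open>c = 0\<close>, as \<open>a\<close> is not
      nilpotent.\<close>
    have "c * r * a ^ n = 0" for r
    proof -
      obtain s where s: "c * r * a ^ n = a ^ n * s"
        using power_normal_left[OF swap] by blast
      have "a ^ Suc n * s = a * (c * r * a ^ n)"
        unfolding s by (simp add: mult.assoc)
      also have "\<dots> = 0"
        using c by (simp add: mult.assoc[symmetric])
      finally show ?thesis
        using n s by simp
    qed
    then have "c = 0 \<or> a ^ n = 0"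
      using pr by blast
    then show ?thesis
      using lpow[of 1 n] by auto
  qed
  obtain u where u: "a = u * b"
    using aI b by blast
  obtain v where v: "b = a * v"
    using bI a by blast
  obtain u' where u': "u * a = a * u'"
    using swap by blast
  \<comment> \<open>Combining \<open>a = u * b\<close> and \<open>b = a * v\<close> gives
    \<open>a = u * a * v\<close>; moving \<open>u\<close> past \<open>a\<close> allows
    \<open>a\<close> to be cancelled, so \<open>v\<close> is a unit with inverse
    \<open>u'\<close>.\<close>
  have "a * (1 - u' * v) = a - u * a * v"
    using u' by (simp add: right_diff_distrib mult.assoc)
  also have "\<dots> = 0"
    using u v by (simp add: mult.assoc)
  finally have "1 - u' * v = 0"
    by (rule r)
  then have "u' * v = 1"
    by simp
  then have vu: "v * u' = 1"
    by (rule right_inverse_imp_left_inverse[OF pir])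
  have "I \<subseteq> range (\<lambda>r. r * a)"
  proof
    fix m assume "m \<in> I"
    then have "m * v \<in> I"
      using I(2) unfolding right_ideal_def by blast
    then obtain s where s: "m * v = s * b"
      using b by blast
    have "m = m * v * u'"
      using vu by (simp add: mult.assoc)
    also have "\<dots> = s * a"
      unfolding s v using vu by (simp add: mult.assoc)
    finally show "m \<in> range (\<lambda>r. r * a)"
      by (rule range_eqI)
  qed
  moreover have "range (\<lambda>r. r * a) \<subseteq> I"
    using I(1) aI unfolding left_ideal_def by blast
  ultimately show ?thesis
    using l r a unfolding regular_def normal_element_def by blast
qed

lemma normal_elementD:
  assumes "normal_element a"
  shows "\<exists>s. r * a = a * s" "\<exists>s. a * r = s * a"
  using assms unfolding normal_element_def by blast+

text \<open>The intersection \<open>J\<close> of the ideals generated by the powers of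
  \<open>a\<close> is two-sided. If nonzero, it has a regular normal generator
  \<open>p = a * q\<close>. Cancelling \<open>a\<close> shows that \<open>q\<close> is again in
  \<open>J\<close>, so \<open>q = t * p\<close>; cancelling \<open>p\<close> gives
  \<open>1 = a * t\<close>.\<close>

lemma Inter_powers_normal_element:
  fixes T :: "'a::ring_1 itself" and a y :: 'a
  assumes prime: "prime_ring T" and pir: "principal_ideal_ring T"
    and a: "regular a" "normal_element a" "1 \<notin> range (\<lambda>r. a * r)"
    and y: "\<And>n. \<exists>z. y = a ^ n * z"
  shows "y = 0"
proof (rule ccontr)
  assume "y \<noteq> 0"
  define J where "J = (\<Inter>n. range (\<lambda>z. a ^ n * z))"
  have rJ: "right_ideal J"
    unfolding J_def by (intro right_ideal_INT right_ideal_range)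
  have "r * x \<in> J" if "x \<in> J" for r x
    unfolding J_def
  proof
    fix n
    obtain z where z: "x = a ^ n * z"
      using \<open>x \<in> J\<close> unfolding J_def by blast
    obtain s where "r * a ^ n = a ^ n * s"
      using power_normal_left normal_elementD(1)[OF a(2)] by blast
    then have "r * x = a ^ n * (s * z)"
      unfolding z by (simp add: mult.assoc[symmetric])
    then show "r * x \<in> range (\<lambda>z. a ^ n * z)"
      by (rule range_eqI)
  qed
  then have lJ: "left_ideal J"
    using rJ unfolding left_ideal_def right_ideal_def by blast
  have "y \<in> J"
    using y unfolding J_def by blast
  then have "J \<noteq> {0}"
    using \<open>y \<noteq> 0\<close> by auto
  then obtain p where p: "regular p" "normal_element p" "J = range (\<lambda>r. p * r)"
    using two_sided_ideal_generator[OF prime pir lJ rJ] by blast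
  then have pJ: "p \<in> J"
    by (metis mult_1_right rangeI)
  then have "p \<in> range (\<lambda>z. a ^ 1 * z)"
    unfolding J_def by blast
  then obtain q where q: "p = a * q"
    by auto
  have "q \<in> J"
    unfolding J_def
  proof
    fix n
    \<comment> \<open>The exponent is one higher because one factor \<open>a\<close> is cancelled in
      passing from \<open>p\<close> to \<open>q\<close>.\<close>
    obtain z where "p = a ^ Suc n * z"
      using pJ unfolding J_def by blast
    then have "a * (q - a ^ n * z) = 0"
      using q by (simp add: right_diff_distrib mult.assoc)
    then have "q = a ^ n * z"
      using a(1) unfolding regular_def by (metis eq_iff_diff_eq_0)
    then show "q \<in> range (\<lambda>z. a ^ n * z)"
      by (rule range_eqI)
  qed
  then obtain t where t: "q = t * p"
    using p normal_elementD(2)[OF p(2)] by blast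
  have "(1 - a * t) * p = 0"
    using q t by (simp add: left_diff_distrib mult.assoc)
  then have "1 = a * t"
    using p(1) unfolding regular_def by (metis eq_iff_diff_eq_0)
  then show False
    using a(3) by blast
qed

section \<open>Rings in which every maximal right ideal is two-sided\<close>

text \<open>The factor \<open>a\<close> generates a maximal right ideal containing \<open>x\<close>.
  It is split off on the right, so that the cofactor \<open>z\<close> generates a right ideal
  containing \<open>x R\<close>, as Noetherian induction requires.\<close>

lemma factor_normal_element:
  fixes T :: "'a::ring_1 itself" and x :: 'a
  assumes prime: "prime_ring T" and pir: "principal_ideal_ring T"
    and max: "\<And>M :: 'a set. maximal_right_ideal M \<Longrightarrow> left_ideal M"
    and x: "x \<noteq> 0" "range (\<lambda>r. x * r) \<noteq> UNIV"
  shows "\<exists>a z. regular a \<and> normal_element a \<and> 1 \<notin> range (\<lambda>r. a * r) \<and> x = z * a"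
proof -
  obtain M where M: "maximal_right_ideal M" "range (\<lambda>r. x * r) \<subseteq> M"
    using exists_maximal_right_ideal[OF pir right_ideal_range x(2)] by blast
  have rM: "right_ideal M" "M \<noteq> UNIV"
    using M unfolding maximal_right_ideal_def by auto
  have "x \<in> M"
    using M(2) by (metis mult_1_right rangeI subsetD)
  then have "M \<noteq> {0}"
    using x by auto
  then obtain a where a: "regular a" "normal_element a" "M = range (\<lambda>r. a * r)"
    using two_sided_ideal_generator[OF prime pir max[OF M(1)] rM(1)] by blast
  have "1 \<notin> M"
    using right_ideal_eq_UNIV rM by blast
  moreover obtain z where "x = z * a"
    using \<open>x \<in> M\<close> a(3) normal_elementD(2)[OF a(2)] by blast
  ultimately show ?thesis
    using a by blast
qed

lemma principal_right_ideal_induct [consumes 1, case_names less]: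
  fixes T :: "'a::ring_1 itself" and P :: "'a \<Rightarrow> bool"
  assumes "principal_ideal_ring T"
    and step: "\<And>x. (\<And>z. range (\<lambda>r. x * r) \<subset> range (\<lambda>r. z * r) \<Longrightarrow> P z) \<Longrightarrow> P x"
  shows "P x"
proof -
  have "wf (inv_image {(J, I :: 'a set). right_ideal I \<and> right_ideal J \<and> I \<subset> J}
      (\<lambda>x. range (\<lambda>r. x * r)))"
    using wf_right_ideals[OF assms(1)] by (rule wf_inv_image)
  then show ?thesis
    by (induction x rule: wf_induct_rule) (simp add: step right_ideal_range)
qed

lemma range_mult_subset: "range (\<lambda>r. z * a * r) \<subseteq> range (\<lambda>r. z * r)" for z a :: "'a::ring_1"
  by (auto simp: mult.assoc)

text \<open>Write \<open>x = z * a\<close> with \<open>a\<close> regular, so that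
  \<open>c * x = 0\<close> forces \<open>c * z = 0\<close>. Induction handles a strictly larger
  \<open>z R\<close>; if \<open>z R = x R\<close>, then \<open>z\<close> lies in every
  \<open>a ^ n R\<close> and vanishes.\<close>

lemma no_zero_divisors_of_maximal_two_sided:
  fixes T :: "'a::ring_1 itself"
  assumes prime: "prime_ring T" and pir: "principal_ideal_ring T"
    and max: "\<And>M :: 'a set. maximal_right_ideal M \<Longrightarrow> left_ideal M"
  shows "no_zero_divisors_ring T"
proof -
  have "\<forall>c. c * x = 0 \<longrightarrow> x = 0 \<or> c = 0" for x :: 'a
    using pir
  proof (induction x rule: principal_right_ideal_induct)
    case (less x)
    show ?case
    proof (intro allI impI, rule ccontr)
      fix c assume c: "c * x = 0" and "\<not> (x = 0 \<or> c = 0)"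
      then have ne: "x \<noteq> 0" "c \<noteq> 0"
        by auto
      have "range (\<lambda>r. x * r) \<noteq> UNIV"
      proof
        assume "range (\<lambda>r. x * r) = UNIV"
        then obtain y where "1 = x * y"
          by blast
        then have "c = c * x * y"
          by (metis mult.assoc mult_1_right)
        then show False
          using c ne by simp
      qed
      then obtain a z where a: "regular a" "normal_element a" "1 \<notin> range (\<lambda>r. a * r)"
          and xz: "x = z * a"
        using factor_normal_element[OF prime pir max ne(1)] by blast
      have "c * z * a = 0"
        using c xz by (simp add: mult.assoc)
      then have "c * z = 0"
        using a(1) unfolding regular_def by blast
      moreover have z0: "z \<noteq> 0"
        using xz ne by auto
      ultimately have "\<not> range (\<lambda>r. x * r) \<subset> range (\<lambda>r. z * r)"
        using less ne(2) by blast
      then have "range (\<lambda>r. x * r) = range (\<lambda>r. z * r)"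
        unfolding xz using range_mult_subset by blast
      then have "z \<in> range (\<lambda>r. x * r)"
        by (metis mult_1_right rangeI)
      then obtain d where d: "z = z * (a * d)"
        using xz by (auto simp: mult.assoc)
      \<comment> \<open>Each substitution into \<open>z = z * (a * d)\<close>, with \<open>a\<close>
        moved left past \<open>w\<close>, gains one factor \<open>a\<close> at the front.\<close>
      have "\<exists>w. z = a ^ n * w" for n
      proof (induction n)
        case (Suc n)
        then obtain w where w: "z = a ^ n * w"
          by blast
        obtain w' where "w * a = a * w'"
          using normal_elementD(1)[OF a(2)] by blast
        then have "a ^ n * w * (a * d) = a ^ n * a * (w' * d)"
          by (metis mult.assoc)
        then have "z = a ^ Suc n * (w' * d)"
          using d w by (simp only: power_Suc2)
        then show ?case by blast
      qed simp
      then have "z = 0"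
        by (rule Inter_powers_normal_element[OF prime pir a])
      then show False
        using z0 by simp
    qed
  qed
  then show ?thesis
    unfolding no_zero_divisors_ring_def by blast
qed

lemma normal_element_mult:
  assumes "normal_element a" "normal_element b"
  shows "normal_element (a * b)"
proof -
  have "\<exists>s. r * (a * b) = a * b * s" for r
    using normal_elementD(1)[OF assms(1)] normal_elementD(1)[OF assms(2)] by (metis mult.assoc)
  moreover have "\<exists>s. a * b * r = s * (a * b)" for r
    using normal_elementD(2)[OF assms(1)] normal_elementD(2)[OF assms(2)] by (metis mult.assoc)
  ultimately show ?thesis
    unfolding normal_element_def by blast
qed

text \<open>Every element is normal by Noetherian induction: zero and units are clear, and otherwise
  \<open>x = z * a\<close> is a product of normal elements.\<close>

lemma duo_ring_of_maximal_two_sided: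
  fixes T :: "'a::ring_1 itself"
  assumes prime: "prime_ring T" and pir: "principal_ideal_ring T"
    and max: "\<And>M :: 'a set. maximal_right_ideal M \<Longrightarrow> left_ideal M"
  shows "duo_ring T"
proof -
  have nzd: "a = 0 \<or> b = 0" if "a * b = 0" for a b :: 'a
    using no_zero_divisors_of_maximal_two_sided[OF prime pir max] that
    unfolding no_zero_divisors_ring_def by blast
  have normal: "normal_element x" for x :: 'a
    using pir
  proof (induction x rule: principal_right_ideal_induct)
    case (less x)
    consider "x = 0" | "range (\<lambda>r. x * r) = UNIV"
      | "x \<noteq> 0" "range (\<lambda>r. x * r) \<noteq> UNIV" by blast
    then show ?case
    proof cases
      case 1
      then show ?thesis
        unfolding normal_element_def by simp
    next
      case 2
      then obtain y where "x * y = 1"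
        by (metis UNIV_I imageE)
      then have "y * x = 1"
        by (rule right_inverse_imp_left_inverse[OF pir])
      then have "r = r * y * x" for r
        by (simp add: mult.assoc)
      then show ?thesis
        using 2 unfolding normal_element_def by blast
    next
      case 3
      then obtain a z where a: "normal_element a" "1 \<notin> range (\<lambda>r. a * r)" and xz: "x = z * a"
        using factor_normal_element[OF prime pir max] by blast
      \<comment> \<open>Absence of zero divisors makes the inclusion strict: equality would give
        \<open>z = z * (a * d)\<close>, and cancelling \<open>z\<close> would make \<open>a\<close>
        right invertible.\<close>
      have "range (\<lambda>r. x * r) \<noteq> range (\<lambda>r. z * r)"
      proof
        assume "range (\<lambda>r. x * r) = range (\<lambda>r. z * r)"
        then have "z \<in> range (\<lambda>r. x * r)"
          by (metis mult_1_right rangeI)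
        then obtain d where "z = z * (a * d)"
          using xz by (auto simp: mult.assoc)
        then have "z * (1 - a * d) = 0"
          by (simp add: right_diff_distrib)
        moreover have "z \<noteq> 0"
          using 3 xz by auto
        ultimately have "1 = a * d"
          using nzd by fastforce
        then show False
          using a by blast
      qed
      then have "normal_element z"
        using less range_mult_subset[of z a] xz by blast
      then show ?thesis
        unfolding xz using a normal_element_mult by blast
    qed
  qed
  show ?thesis
    unfolding duo_ring_def
  proof (intro allI conjI impI)
    fix I :: "'a set" assume "left_ideal I"
    then obtain a where "I = range (\<lambda>r. r * a)"
      using pir unfolding principal_ideal_ring_def by blast
    then show "right_ideal I"
      using normal[of a] right_ideal_range[of a] unfolding normal_element_def by simp
  next
    fix I :: "'a set" assume "right_ideal I"
    then obtain a where "I = range (\<lambda>r. a * r)"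
      using pir unfolding principal_ideal_ring_def by blast
    then show "left_ideal I"
      using normal[of a] left_ideal_range[of a] unfolding normal_element_def by simp
  qed
qed

section \<open>Atoms and conjugates in the quotient division ring\<close>

text \<open>If \<open>x = a * b\<close>, then \<open>a R\<close> contains \<open>x R\<close>. By
  maximality either the two agree and \<open>b\<close> is right invertible, or \<open>a R\<close> is
  everything and \<open>a\<close> is; in a domain a right inverse is two-sided.\<close>

lemma atom_generator_of_maximal_right_ideal:
  fixes T :: "'a::ring_1 itself" and x :: 'a
  assumes "no_zero_divisors_ring T" and M: "maximal_right_ideal (range (\<lambda>r. x * r))" and "x \<noteq> 0"
  shows "atom x"
proof -
  have nzd: "a = 0 \<or> b = 0" if "a * b = 0" for a b :: 'a
    using assms(1) that unfolding no_zero_divisors_ring_def by blast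
  have unitI: "is_unit a" if "a * b = 1" for a b :: 'a
  proof -
    have "a * (b * a - 1) = 0"
      using that by (simp add: right_diff_distrib mult.assoc[symmetric])
    moreover have "a \<noteq> 0"
      using that by auto
    ultimately show ?thesis
      using that nzd unfolding is_unit_def by fastforce
  qed
  have "\<not> is_unit x"
  proof
    assume "is_unit x"
    then have "1 \<in> range (\<lambda>r. x * r)"
      unfolding is_unit_def by (metis rangeI)
    then show False
      using M right_ideal_eq_UNIV unfolding maximal_right_ideal_def by blast
  qed
  moreover have "is_unit a \<or> is_unit b" if x: "x = a * b" for a b
  proof -
    have "range (\<lambda>r. x * r) \<subseteq> range (\<lambda>r. a * r)"
      unfolding x by (rule range_mult_subset)
    then consider "range (\<lambda>r. a * r) = range (\<lambda>r. x * r)" | "range (\<lambda>r. a * r) = UNIV"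
      using M right_ideal_range[of a] unfolding maximal_right_ideal_def by blast
    then show ?thesis
    proof cases
      case 1
      then have "a \<in> range (\<lambda>r. x * r)"
        by (metis mult_1_right rangeI)
      then obtain c where "a = a * (b * c)"
        using x by (auto simp: mult.assoc)
      then have "a * (1 - b * c) = 0"
        by (simp add: right_diff_distrib)
      moreover have "a \<noteq> 0"
        using x assms(3) by auto
      ultimately have "b * c = 1"
        using nzd by fastforce
      then show ?thesis
        using unitI by blast
    next
      case 2
      then obtain c where "a * c = 1"
        by (metis UNIV_I imageE)
      then show ?thesis
        using unitI by blast
    qed
  qed
  ultimately show ?thesis
    using assms(3) unfolding atom_def by blast
qed

text \<open>Clearing the denominator turns membership into \<open>r * x = x * s\<close> inside the
  ring, so the conjugate does not depend on \<open>phi\<close>.\<close>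

lemma conj_left_eq_idealizer:
  fixes phi :: "'a::ring_1 \<Rightarrow> 'b::division_ring"
  assumes "division_ring_of_quotients phi" and "x \<noteq> 0"
  shows "conj_left phi x = idealizer (range (\<lambda>r. x * r))"
proof -
  have inj: "inj phi" and add: "\<And>a b. phi (a + b) = phi a + phi b"
      and mult: "\<And>a b. phi (a * b) = phi a * phi b"
    using assms(1) unfolding division_ring_of_quotients_def by auto
  have "phi 0 = 0"
    using add[of 0 0] by simp
  then have nz: "phi x \<noteq> 0"
    using inj assms(2) by (metis injD)
  have "phi r = phi x * phi s * inverse (phi x) \<longleftrightarrow> r * x = x * s" for r s
  proof -
    have "phi r = phi x * phi s * inverse (phi x) \<longleftrightarrow> phi r * phi x = phi x * phi s"
      using nz by (metis divide_inverse eq_divide_eq)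
    also have "\<dots> \<longleftrightarrow> r * x = x * s"
      using inj by (metis injD mult)
    finally show ?thesis .
  qed
  moreover have "r \<in> idealizer (range (\<lambda>r. x * r)) \<longleftrightarrow> (\<exists>s. r * x = x * s)" for r
  proof
    assume "r \<in> idealizer (range (\<lambda>r. x * r))"
    then have "r * (x * 1) \<in> range (\<lambda>r. x * r)"
      unfolding idealizer_def by blast
    then show "\<exists>s. r * x = x * s"
      by auto
  next
    assume "\<exists>s. r * x = x * s"
    then obtain s where "r * x = x * s"
      by blast
    then have "r * (x * t) = x * (s * t)" for t
      by (metis mult.assoc)
    then show "r \<in> idealizer (range (\<lambda>r. x * r))"
      unfolding idealizer_def by auto
  qed
  ultimately show ?thesis
    unfolding conj_left_def by auto
qed

theorem theorem2p10:
  fixes T :: "'a::ring_1 itself"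
  assumes "prime_ring T" and "principal_ideal_ring T"
  shows "(has_maximal_subring T \<or> (duo_ring T \<and> principal_ideal_domain T)) \<and>
         (principal_ideal_domain T \<and> \<not> duo_ring T \<longrightarrow>
            (\<exists>x::'a. atom x \<and>
               ((\<forall>phi :: 'a \<Rightarrow> 'b::division_ring. division_ring_of_quotients phi \<longrightarrow>
                   maximal_subring (conj_left phi x)) \<or>
                (\<forall>phi :: 'a \<Rightarrow> 'b::division_ring. division_ring_of_quotients phi \<longrightarrow>
                   maximal_subring (conj_right phi x)))))"
proof (cases "\<forall>M :: 'a set. maximal_right_ideal M \<longrightarrow> left_ideal M")
  case True
  \<comment> \<open>The ring is a duo principal ideal domain here, so the second conjunct holds
    vacuously.\<close>
  then show ?thesis
    using no_zero_divisors_of_maximal_two_sided[OF assms] duo_ring_of_maximal_two_sided[OF assms]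
      assms(2) unfolding principal_ideal_domain_def by blast
next
  case False
  then obtain M :: "'a set" where M: "maximal_right_ideal M" "\<not> left_ideal M"
    by blast
  then have sub: "maximal_subring (idealizer M)"
    by (rule maximal_subring_idealizer)
  obtain x where x: "M = range (\<lambda>r. x * r)"
    using M(1) assms(2) unfolding maximal_right_ideal_def principal_ideal_ring_def by blast
  \<comment> \<open>The zero ideal is a left ideal, whereas \<open>M\<close> is not.\<close>
  have "x \<noteq> 0"
  proof
    assume "x = 0"
    then have "M = {0}"
      using x by auto
    then show False
      using M(2) unfolding left_ideal_def by simp
  qed
  then have "atom x" if "principal_ideal_domain T"
    using atom_generator_of_maximal_right_ideal that M(1) x
    unfolding principal_ideal_domain_def by blast
  \<comment> \<open>The \<open>conj_left\<close> alternative is the one established, with the same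
    \<open>x\<close> for every \<open>phi\<close>.\<close>
  moreover have "maximal_subring (conj_left phi x)"
    if "division_ring_of_quotients phi" for phi :: "'a \<Rightarrow> 'b"
    using conj_left_eq_idealizer[OF that \<open>x \<noteq> 0\<close>] sub x by simp
  ultimately show ?thesis
    using sub unfolding has_maximal_subring_def by blast
qed

end
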